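(* Let $X,Y$ be Banach spaces, let $A:D(A)\subset X\to X$ generate a $C_0$-semigroup $T(\cdot)$ on $X$, and let $C\in\mathcal L(X,Y)$. Assume that the system $\dot x(t)=Ax(t)$, $y(t)=Cx(t)$ is exponentially detectable, i.e. there is $L\in\mathcal L(Y,X)$ such that $A+LC$ generates a uniformly exponentially stable semigroup $T_{LC}(\cdot)$ on $X$, so that for some $M,\mu>0$ one has $\|T_{LC}(t)x\|_X\le Me^{-\mu t}\|x\|_X$ for all $x\in X$, $t\ge0$. For any $\eta\in(0,\mu)$ define $$V^\eta(x):=\max_{s\ge0}\bigl\|e^{\eta s}T_{LC}(s)x\bigr\|_X,\quad x\in X.$$ Then $V^\eta$ is a coercive eOSS Lyapunov function in dissipation form with linear $\sigma$ and $p=1$ for the system $\dot x(t)=Ax(t)$, $y(t)=Cx(t)$.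
   Context: $\mathcal L(X,Y)$ denotes the bounded linear operators from $X$ to $Y$. $\mathbb R_+=[0,\infty)$; $\mathcal K_\infty$ is the set of continuous, strictly increasing, unbounded $\gamma:\mathbb R_+\to\mathbb R_+$ with $\gamma(0)=0$. The mild solution of the system with initial state $x\in X$ is $\phi(t,x)=T(t)x$, $t\ge0$. Lie derivative (along the system $\dot x=Ax$): $\dot V(x):=\limsup_{\tau\to+0}\frac{V(\phi(\tau,x))-V(x)}{\tau}$ (limsup in the extended real line), provided $t\mapsto V(\phi(t,x))$ is continuous at $t=0$. $V:X\to\mathbb R_+$ is a coercive eOSS Lyapunov function in dissipation form if: (a) there exist $k_1,k_2,p>0$ with $k_1\|x\|_X^p\le V(x)\le k_2\|x\|_X^p$ for all $x\in X$; (b) for every $x\in X$ the map $t\mapsto V(\phi(t,x))$, $t\ge0$, is continuous; (c) there exist $\alpha>0$ and $\sigma\in\mathcal K_\infty$ such that, with $p$ as in (a), $\dot V(x)\le-\alpha\|x\|_X^p+\sigma(\|Cx\|_Y)$ for all $x\in X$. *)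

theory Defs
  imports "HOL-Analysis.Analysis"
begin

text \<open>
  Semigroups are indexed by type \<^typ>\<open>real\<close>; only their values at times \<open>t \<ge> 0\<close> are
  constrained or used.  Likewise comparison functions have type \<^typ>\<open>real \<Rightarrow> real\<close> but
  only their restriction to \<open>{0..}\<close> matters.
\<close>

definition C0_semigroup :: "(real \<Rightarrow> 'a::real_normed_vector \<Rightarrow>\<^sub>L 'a) \<Rightarrow> bool" where
  "C0_semigroup T \<longleftrightarrow>
     T 0 = id_blinfun \<and>
     (\<forall>s\<ge>0. \<forall>t\<ge>0. T (s + t) = T s o\<^sub>L T t) \<and>
     (\<forall>x. ((\<lambda>t. blinfun_apply (T t) x) \<longlongrightarrow> x) (at_right 0))"

text \<open>
  An unbounded operator is a pair of a domain \<open>D\<close> and a map \<open>A\<close> whose values outside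
  \<open>D\<close> are irrelevant.  The generator has as its domain exactly those points at which the
  difference quotient converges.
\<close>

definition generates ::
    "'a set \<Rightarrow> ('a \<Rightarrow> 'a) \<Rightarrow> (real \<Rightarrow> 'a::real_normed_vector \<Rightarrow>\<^sub>L 'a) \<Rightarrow> bool" where
  "generates D A T \<longleftrightarrow>
     C0_semigroup T \<and>
     D = {x. \<exists>y. ((\<lambda>h. (blinfun_apply (T h) x - x) /\<^sub>R h) \<longlongrightarrow> y) (at_right 0)} \<and>
     (\<forall>x\<in>D. ((\<lambda>h. (blinfun_apply (T h) x - x) /\<^sub>R h) \<longlongrightarrow> A x) (at_right 0))"

definition mild_solution ::
    "(real \<Rightarrow> 'a::real_normed_vector \<Rightarrow>\<^sub>L 'a) \<Rightarrow> real \<Rightarrow> 'a \<Rightarrow> 'a" where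
  "mild_solution T t x = blinfun_apply (T t) x"

definition class_K_infinity :: "(real \<Rightarrow> real) set" where
  "class_K_infinity = {\<gamma>.
     \<gamma> ` {0..} \<subseteq> {0..} \<and> continuous_on {0..} \<gamma> \<and> strict_mono_on {0..} \<gamma> \<and>
     \<not> bdd_above (\<gamma> ` {0..}) \<and> \<gamma> 0 = 0}"

text \<open>
  Meaningful only if \<open>t \<mapsto> V (\<phi> t x)\<close> is continuous from the right at \<open>0\<close>; in the
  definition of a Lyapunov function below this is ensured by the continuity clause.
\<close>

definition lie_derivative ::
    "(real \<Rightarrow> 'a \<Rightarrow> 'a) \<Rightarrow> ('a \<Rightarrow> real) \<Rightarrow> 'a \<Rightarrow> ereal" where
  "lie_derivative \<phi> V x =
     Limsup (at_right 0) (\<lambda>\<tau>. ereal ((V (\<phi> \<tau> x) - V x) / \<tau>))"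

text \<open>
  The exponent \<open>p\<close> and the gain \<open>\<sigma>\<close> are parameters so that statements can prescribe them.
\<close>

definition coercive_eOSS_Lyapunov_with ::
    "real \<Rightarrow> (real \<Rightarrow> real) \<Rightarrow> (real \<Rightarrow> 'a::real_normed_vector \<Rightarrow>\<^sub>L 'a) \<Rightarrow>
     ('a \<Rightarrow>\<^sub>L 'b::real_normed_vector) \<Rightarrow> ('a \<Rightarrow> real) \<Rightarrow> bool" where
  "coercive_eOSS_Lyapunov_with p \<sigma> T C V \<longleftrightarrow>
     p > 0 \<and> \<sigma> \<in> class_K_infinity \<and> (\<forall>x. 0 \<le> V x) \<and>
     (\<exists>k1>0. \<exists>k2>0. \<forall>x. k1 * norm x powr p \<le> V x \<and> V x \<le> k2 * norm x powr p) \<and>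
     (\<forall>x. continuous_on {0..} (\<lambda>t. V (mild_solution T t x))) \<and>
     (\<exists>\<alpha>>0. \<forall>x. lie_derivative (mild_solution T) V x
        \<le> ereal (- \<alpha> * norm x powr p + \<sigma> (norm (blinfun_apply C x))))"

text \<open>
  A maximum in the literal sense: \<^const>\<open>Greatest\<close> has a specified value only if the
  maximum is attained.
\<close>

definition V_max :: "(real \<Rightarrow> 'a::real_normed_vector \<Rightarrow>\<^sub>L 'a) \<Rightarrow> real \<Rightarrow> 'a \<Rightarrow> real" where
  "V_max S \<eta> x = (GREATEST v. \<exists>s\<ge>0. v = norm (exp (\<eta> * s) *\<^sub>R blinfun_apply (S s) x))"

end

theory Submission
  imports Defs "HOL-Real_Asymp.Real_Asymp"
begin

text \<open>
  Write \<open>S\<close> for the stable semigroup \<open>T_LC\<close> and \<open>V\<close> for the function \<open>V\<^sup>\<eta>\<close>.  The weight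
  \<open>exp (\<eta> s)\<close> grows more slowly than \<open>S\<close> decays, so \<open>s \<mapsto> exp (\<eta> s) \<parallel>S(s)x\<parallel>\<close> is continuous and
  vanishes at infinity.  Hence it attains its maximum, and \<open>V\<close> is a norm with
  \<open>\<parallel>x\<parallel> \<le> V x \<le> M \<parallel>x\<parallel>\<close>.  Shifting the time variable of the maximum turns the weight into a
  contraction estimate, \<open>V (S(t)x) \<le> exp (- \<eta> t) V x\<close>.

  It remains to compare the orbits of \<open>T\<close> with those of \<open>S\<close>.  By subadditivity,
  \<open>V (T(h)x) \<le> exp (- \<eta> h) V x + M \<parallel>S(h)x - T(h)x\<parallel>\<close>.
  The dissipation inequality, with \<open>\<alpha> = \<eta>\<close> and any linear gain of positive slope at least \<open>M \<parallel>L\<parallel>\<close>,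
  therefore follows once \<open>(S(h)x - T(h)x) / h \<longlongrightarrow> L C x\<close> as \<open>h\<close> decreases to \<open>0\<close>.

  For \<open>x\<close> in the common domain of the generators this limit is immediate, but the dissipation
  inequality is required at every \<open>x\<close>, where neither difference quotient need converge.  The
  limit is usually read off from the variation of constants formula.  Here it is obtained from
  a mean value inequality: for \<open>x\<close> in the domain, \<open>s \<mapsto> S(h - s) T(s) x\<close> has right derivative
  \<open>- S(h - s) L C T(s) x\<close>, in which the unbounded operator \<open>A\<close> no longer occurs.  This bounds
  \<open>\<parallel>S(h)x - T(h)x - h L C x\<parallel>\<close> by \<open>h\<close> times a quantity that depends continuously on \<open>x\<close> in the norm
  of the space, so the bound passes from the dense domain to all \<open>x\<close>
  (\<open>perturbed_semigroup_expansion_on_domain\<close> and \<open>perturbed_semigroup_difference_quotient\<close>).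
\<close>

section \<open>Strongly continuous semigroups\<close>

text \<open>
  The sets where all \<open>f\<close> are bounded by \<open>n\<close> are closed and cover the space, so by Baire's
  theorem one of them contains a ball.
\<close>

lemma uniform_boundedness_principle:
  fixes F :: "('a::banach \<Rightarrow>\<^sub>L 'b::real_normed_vector) set"
  assumes "\<And>x. \<exists>c. \<forall>f\<in>F. norm (blinfun_apply f x) \<le> c"
  shows "\<exists>K. \<forall>f\<in>F. norm f \<le> K"
proof -
  define E where "E n = {x. \<forall>f\<in>F. norm (blinfun_apply f x) \<le> real n}" for n
  have closed_E: "closed (E n)" for n
  proof -
    have "E n = (\<Inter>f\<in>F. {x. norm (blinfun_apply f x) \<le> real n})"
      by (auto simp: E_def)
    moreover have "closed {x. norm (blinfun_apply f x) \<le> real n}" for f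
      by (intro closed_Collect_le continuous_intros)
    ultimately show ?thesis by auto
  qed
  have "x \<in> (\<Union>n. E n)" for x
  proof -
    obtain c where "\<forall>f\<in>F. norm (blinfun_apply f x) \<le> c" using assms by blast
    moreover obtain n where "c \<le> real n" using real_arch_simple by blast
    ultimately have "x \<in> E n" by (force simp: E_def)
    then show ?thesis by blast
  qed
  then have cover: "\<Union>(range E) = UNIV" by blast
  have "\<exists>n. interior (E n) \<noteq> {}"
  proof (rule ccontr)
    assume "\<not> ?thesis"
    then have "euclidean interior_of \<Union>(range E) = {}"
      using closed_E
      by (intro Baire_category_alt)
         (auto simp: completely_metrizable_space_euclidean)
    then show False using cover by simp
  qed
  then obtain n a where "a \<in> interior (E n)" by blast
  then obtain e where e: "e > 0" "cball a e \<subseteq> E n"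
    using mem_interior_cball by blast
  have "norm f \<le> 2 * real n / e" if f: "f \<in> F" for f
  proof (rule norm_blinfun_bound)
    show "0 \<le> 2 * real n / e" using e by simp
    \<comment> \<open>Scaling \<open>x\<close> to length \<open>e\<close> makes it a difference of two points of the ball around \<open>a\<close>,
      each of which \<open>f\<close> maps to a vector of norm at most \<open>n\<close>.\<close>
    fix x
    show "norm (blinfun_apply f x) \<le> 2 * real n / e * norm x"
    proof (cases "x = 0")
      case False
      define y where "y = (e / norm x) *\<^sub>R x"
      have "a \<in> E n" "a + y \<in> E n"
        using e False by (auto simp: y_def dist_norm intro!: subsetD[OF e(2)])
      then have "norm (blinfun_apply f a) \<le> n" "norm (blinfun_apply f (a + y)) \<le> n"
        using f by (auto simp: E_def)
      moreover have "blinfun_apply f y = blinfun_apply f (a + y) - blinfun_apply f a"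
        by (simp add: blinfun.add_right)
      ultimately have "norm (blinfun_apply f y) \<le> 2 * real n"
        using norm_triangle_ineq4[of "blinfun_apply f (a + y)" "blinfun_apply f a"] by simp
      then show ?thesis
        using e False by (simp add: y_def blinfun.scaleR_right field_simps)
    qed simp
  qed
  then show ?thesis by blast
qed

lemma C0_semigroup_0: "C0_semigroup T \<Longrightarrow> blinfun_apply (T 0) x = x"
  by (simp add: C0_semigroup_def)

lemma C0_semigroup_compose:
  "C0_semigroup T \<Longrightarrow> 0 \<le> s \<Longrightarrow> 0 \<le> t \<Longrightarrow> T (s + t) = T s o\<^sub>L T t"
  by (simp add: C0_semigroup_def)

lemma C0_semigroup_add:
  "C0_semigroup T \<Longrightarrow> 0 \<le> s \<Longrightarrow> 0 \<le> t \<Longrightarrow>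
     blinfun_apply (T (s + t)) x = blinfun_apply (T s) (blinfun_apply (T t) x)"
  by (simp add: C0_semigroup_compose)

lemma C0_semigroup_tendsto_at_0:
  "C0_semigroup T \<Longrightarrow> ((\<lambda>t. blinfun_apply (T t) x) \<longlongrightarrow> x) (at_right 0)"
  by (simp add: C0_semigroup_def)

text \<open>
  If the bound failed on every interval, there would be times \<open>h n \<longlonglongrightarrow> 0\<close> with
  \<open>norm (T (h n)) > n\<close>, although each orbit \<open>T (h n) x\<close> converges and is bounded.
\<close>

lemma C0_semigroup_bounded_near_0:
  fixes T :: "real \<Rightarrow> 'a::banach \<Rightarrow>\<^sub>L 'a"
  assumes "C0_semigroup T"
  shows "\<exists>d>0. \<exists>K. \<forall>h\<in>{0..d}. norm (T h) \<le> K"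
proof (rule ccontr)
  assume neg: "\<not> ?thesis"
  have "\<exists>h. 0 < h \<and> h \<le> 1 / real (Suc n) \<and> norm (T h) > real n" for n
  proof -
    \<comment> \<open>Including \<open>norm (T 0)\<close> in the bound forces the time found to be nonzero.\<close>
    have "\<not> (\<forall>h\<in>{0..1 / real (Suc n)}. norm (T h) \<le> max (real n) (norm (T 0)))"
      using neg by (metis divide_pos_pos of_nat_0_less_iff zero_less_Suc zero_less_one)
    then obtain h where "h \<in> {0..1 / real (Suc n)}" "norm (T h) > max (real n) (norm (T 0))"
      by (auto simp: not_le)
    then show ?thesis by (intro exI[of _ h]) (auto simp: order.order_iff_strict)
  qed
  then obtain h where h: "0 < h n" "h n \<le> 1 / real (Suc n)" "norm (T (h n)) > real n" for n
    by metis
  have "h \<longlonglongrightarrow> 0"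
    using h(2) less_imp_le[OF h(1)]
    by (intro tendsto_sandwich[OF _ _ tendsto_const LIMSEQ_Suc[OF lim_const_over_n[of 1]]]) auto
  then have lim: "filterlim h (at_right 0) sequentially"
    using h(1) by (simp add: filterlim_at less_imp_neq[symmetric])
  have "\<exists>c. \<forall>f\<in>range (\<lambda>n. T (h n)). norm (blinfun_apply f x) \<le> c" for x
  proof -
    have "(\<lambda>n. blinfun_apply (T (h n)) x) \<longlonglongrightarrow> x"
      by (rule filterlim_compose[OF C0_semigroup_tendsto_at_0[OF assms] lim])
    then have "Bseq (\<lambda>n. blinfun_apply (T (h n)) x)"
      by (meson convergentI convergent_imp_Bseq)
    then show ?thesis by (auto simp: Bseq_def)
  qed
  then obtain K where K: "\<forall>f\<in>range (\<lambda>n. T (h n)). norm f \<le> K"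
    using uniform_boundedness_principle by blast
  obtain n where "K \<le> real n" using real_arch_simple by blast
  moreover have "norm (T (h n)) \<le> K" using K by blast
  ultimately show False using h(3)[of n] by linarith
qed

lemma C0_semigroup_bounded_on_compact:
  fixes T :: "real \<Rightarrow> 'a::banach \<Rightarrow>\<^sub>L 'a"
  assumes "C0_semigroup T"
  shows "\<exists>K\<ge>0. \<forall>t\<in>{0..b}. norm (T t) \<le> K"
proof -
  obtain d K where dK: "d > 0" "\<And>h. h \<in> {0..d} \<Longrightarrow> norm (T h) \<le> K"
    using C0_semigroup_bounded_near_0[OF assms] by blast
  have K0: "K \<ge> 0" using order_trans[OF norm_ge_zero dK(2)[of 0]] dK(1) by simp
  have step: "\<exists>K'\<ge>0. \<forall>t\<in>{0..real n * d}. norm (T t) \<le> K'" for n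
  proof (induction n)
    case 0
    then show ?case by (auto intro!: exI[of _ "norm (T 0)"])
  next
    case (Suc n)
    then obtain K' where K': "K' \<ge> 0" "\<And>t. t \<in> {0..real n * d} \<Longrightarrow> norm (T t) \<le> K'" by blast
    have "norm (T t) \<le> max K (K * K')" if t: "t \<in> {0..real (Suc n) * d}" for t
    proof (cases "t \<le> d")
      case True
      then show ?thesis using dK(2)[of t] t by auto
    next
      case False
      then have "T t = T d o\<^sub>L T (t - d)"
        using C0_semigroup_compose[OF assms, of d "t - d"] dK(1) by simp
      then have "norm (T t) \<le> norm (T d) * norm (T (t - d))"
        by (simp add: norm_blinfun_compose)
      also have "\<dots> \<le> K * K'"
        using dK False t K0 by (intro mult_mono K') (auto simp: algebra_simps)
      finally show ?thesis by simp
    qed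
    then show ?case using K0 by (intro exI[of _ "max K (K * K')"]) auto
  qed
  obtain n where "b / d \<le> real n" using real_arch_simple by blast
  then have "b \<le> real n * d" using dK(1) by (simp add: field_simps)
  moreover obtain K' where "K' \<ge> 0" "\<forall>t\<in>{0..real n * d}. norm (T t) \<le> K'"
    using step by blast
  ultimately show ?thesis by (intro exI[of _ K']) auto
qed

text \<open>
  Right continuity comes from continuity at \<open>0\<close>.  For times \<open>s < t\<close> one factors out
  \<open>T s\<close>, which varies with \<open>s\<close>, so continuity from the left needs the bound on compact intervals.
\<close>

lemma C0_semigroup_tendsto_orbit:
  fixes T :: "real \<Rightarrow> 'a::banach \<Rightarrow>\<^sub>L 'a"
  assumes T: "C0_semigroup T" and t: "t \<ge> 0"
  shows "((\<lambda>s. blinfun_apply (T s) x) \<longlongrightarrow> blinfun_apply (T t) x) (at t within {0..})"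
proof -
  obtain K where K: "K \<ge> 0" "\<And>s. s \<in> {0..t+1} \<Longrightarrow> norm (T s) \<le> K"
    using C0_semigroup_bounded_on_compact[OF T] by blast
  have ordered: "norm (blinfun_apply (T r) x - blinfun_apply (T s) x)
      \<le> K * norm (blinfun_apply (T (r - s)) x - x)" if "0 \<le> s" "s \<le> r" "s \<le> t + 1" for r s
  proof -
    have "blinfun_apply (T r) x - blinfun_apply (T s) x
        = blinfun_apply (T s) (blinfun_apply (T (r - s)) x - x)"
      using C0_semigroup_add[OF T, of s "r - s" x] that by (simp add: blinfun.diff_right)
    then show ?thesis
      using order_trans[OF norm_blinfun mult_right_mono[OF K(2)]] that by simp
  qed
  have bound: "norm (blinfun_apply (T s) x - blinfun_apply (T t) x)
      \<le> K * norm (blinfun_apply (T \<bar>s - t\<bar>) x - x)" if "0 \<le> s" for s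
    using ordered[of s t] ordered[of t s] that t
    by (cases "s \<le> t") (auto simp: norm_minus_commute)
  have "filterlim (\<lambda>s. \<bar>s - t\<bar>) (at_right 0) (at t within {0..})"
    unfolding filterlim_at
    by (auto intro!: tendsto_eq_intros simp: eventually_at_filter)
  then have "((\<lambda>s. blinfun_apply (T \<bar>s - t\<bar>) x) \<longlongrightarrow> x) (at t within {0..})"
    by (rule filterlim_compose[OF C0_semigroup_tendsto_at_0[OF T]])
  then have "((\<lambda>s. K * norm (blinfun_apply (T \<bar>s - t\<bar>) x - x)) \<longlongrightarrow> 0) (at t within {0..})"
    by (intro tendsto_mult_right_zero tendsto_norm_zero LIM_zero)
  then have "((\<lambda>s. blinfun_apply (T s) x - blinfun_apply (T t) x) \<longlongrightarrow> 0) (at t within {0..})"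
    by (rule Lim_null_comparison[rotated])
       (auto simp: eventually_at_filter bound)
  then show ?thesis using Lim_null by blast
qed

lemma C0_semigroup_continuous_orbit:
  fixes T :: "real \<Rightarrow> 'a::banach \<Rightarrow>\<^sub>L 'a"
  assumes "C0_semigroup T"
  shows "continuous_on {0..} (\<lambda>t. blinfun_apply (T t) x)"
  using C0_semigroup_tendsto_orbit[OF assms] by (simp add: continuous_on_def)

text \<open>
  Joint continuity in time and state, stated along a filter so that it also applies to
  compositions such as \<open>s \<mapsto> S(h - s) T(s) x\<close>.
\<close>

lemma C0_semigroup_tendsto:
  fixes T :: "real \<Rightarrow> 'a::banach \<Rightarrow>\<^sub>L 'a"
  assumes T: "C0_semigroup T"
    and g: "(g \<longlongrightarrow> t) F" "eventually (\<lambda>p. g p \<ge> 0) F" and t: "t \<ge> 0"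
    and z: "(z \<longlongrightarrow> z0) F"
  shows "((\<lambda>p. blinfun_apply (T (g p)) (z p)) \<longlongrightarrow> blinfun_apply (T t) z0) F"
proof -
  obtain K where K: "K \<ge> 0" "\<And>s. s \<in> {0..t+1} \<Longrightarrow> norm (T s) \<le> K"
    using C0_semigroup_bounded_on_compact[OF T] by blast
  have orbit: "((\<lambda>p. blinfun_apply (T (g p)) z0) \<longlongrightarrow> blinfun_apply (T t) z0) F"
    using g t by (intro continuous_on_tendsto_compose[OF C0_semigroup_continuous_orbit[OF T]]) auto
  have "eventually (\<lambda>p. g p \<le> t + 1) F"
    using order_tendstoD(2)[OF g(1), of "t + 1"] by (auto elim: eventually_mono)
  then have "eventually (\<lambda>p. norm (blinfun_apply (T (g p)) (z p - z0)) \<le> K * norm (z p - z0)) F"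
    using g(2)
  proof eventually_elim
    case (elim p)
    then show ?case
      using order_trans[OF norm_blinfun mult_right_mono[OF K(2)]] by simp
  qed
  moreover have "((\<lambda>p. K * norm (z p - z0)) \<longlongrightarrow> 0) F"
    using z by (intro tendsto_mult_right_zero tendsto_norm_zero LIM_zero)
  ultimately have "((\<lambda>p. blinfun_apply (T (g p)) (z p - z0)) \<longlongrightarrow> 0) F"
    by (rule Lim_null_comparison)
  from tendsto_add[OF this orbit] show ?thesis by (simp add: blinfun.diff_right)
qed

section \<open>The domain of the generator\<close>

lemma vector_derivative_imp_right_quotient:
  fixes f :: "real \<Rightarrow> 'a::real_normed_vector"
  assumes "(f has_vector_derivative d) (at r within {r..b})" and "r < b"
  shows "((\<lambda>h. (f (r + h) - f r) /\<^sub>R h) \<longlongrightarrow> d) (at_right 0)"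
proof -
  have "at r within {r..b} = at_right r"
    using \<open>r < b\<close> by (rule at_within_Icc_at_right)
  then have "((\<lambda>u. ((f u - f r) - (u - r) *\<^sub>R d) /\<^sub>R norm (u - r)) \<longlongrightarrow> 0) (at_right r)"
    using assms(1) by (simp add: has_vector_derivative_def has_derivative_at_within)
  then have "((\<lambda>h. ((f (r + h) - f r) - h *\<^sub>R d) /\<^sub>R norm h) \<longlongrightarrow> 0) (at_right 0)"
    by (subst (asm) filterlim_at_right_to_0) (simp add: add.commute)
  then have "((\<lambda>h. ((f (r + h) - f r) /\<^sub>R h) - d) \<longlongrightarrow> 0) (at_right 0)"
    by (rule Lim_transform_eventually)
       (auto simp: eventually_at_filter scaleR_diff_right)
  then show ?thesis using Lim_null by blast
qed

lemma integral_right_quotient: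
  fixes f :: "real \<Rightarrow> 'a::banach"
  assumes f: "continuous_on {0..} f" and r: "r \<ge> 0"
  shows "((\<lambda>h. (integral {0..r + h} f - integral {0..r} f) /\<^sub>R h) \<longlongrightarrow> f r) (at_right 0)"
proof (rule vector_derivative_imp_right_quotient)
  have "((\<lambda>u. integral {0..u} f) has_vector_derivative f r) (at r within {0..r + 1})"
    using r by (intro integral_has_vector_derivative continuous_on_subset[OF f]) auto
  then show "((\<lambda>u. integral {0..u} f) has_vector_derivative f r) (at r within {r..r + 1})"
    by (rule has_vector_derivative_within_subset) (use r in auto)
qed simp

lemma generator_domainI:
  assumes "generates D A T"
    and "((\<lambda>h. (blinfun_apply (T h) x - x) /\<^sub>R h) \<longlongrightarrow> y) (at_right 0)"
  shows "x \<in> D"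
proof -
  have D: "D = {x. \<exists>y. ((\<lambda>h. (blinfun_apply (T h) x - x) /\<^sub>R h) \<longlongrightarrow> y) (at_right 0)}"
    using assms(1) unfolding generates_def by (elim conjE)
  show ?thesis
    unfolding D by (rule CollectI) (rule exI, rule assms(2))
qed

lemma generator_tendsto:
  assumes "generates D A T" and "x \<in> D"
  shows "((\<lambda>h. (blinfun_apply (T h) x - x) /\<^sub>R h) \<longlongrightarrow> A x) (at_right 0)"
proof -
  have "\<forall>x\<in>D. ((\<lambda>h. (blinfun_apply (T h) x - x) /\<^sub>R h) \<longlongrightarrow> A x) (at_right 0)"
    using assms(1) unfolding generates_def by (elim conjE)
  then show ?thesis using assms(2) by (rule bspec)
qed

text \<open>
  The vector \<open>x\<close> is the limit of its orbit averages \<open>(1 / h) \<integral>\<^sub>0\<^sup>h S(s) x ds\<close>, and averaging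
  smooths: applying \<open>S h - I\<close> to an integral of the orbit changes only the end points
  of the interval of integration, so the difference quotient converges.
\<close>

lemma generator_domain_dense:
  fixes S :: "real \<Rightarrow> 'a::banach \<Rightarrow>\<^sub>L 'a"
  assumes gen: "generates D A S"
  shows "closure D = UNIV"
proof -
  have S: "C0_semigroup S" using gen by (simp add: generates_def)
  have "x \<in> closure D" for x
  proof -
    define f where "f t = blinfun_apply (S t) x" for t
    define F where "F t = integral {0..t} f" for t
    have f: "continuous_on {0..} f"
      unfolding f_def by (rule C0_semigroup_continuous_orbit[OF S])
    have int: "f integrable_on {a..b}" if "0 \<le> a" for a b
      using that by (intro integrable_continuous_real continuous_on_subset[OF f]) auto
    have quot: "((\<lambda>h. (F (r + h) - F r) /\<^sub>R h) \<longlongrightarrow> f r) (at_right 0)" if "r \<ge> 0" for r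
      unfolding F_def by (rule integral_right_quotient[OF f that])
    have F0: "F 0 = 0" by (simp add: F_def)
    have SF: "blinfun_apply (S h) (F r) - F r = (F (r + h) - F r) - (F (0 + h) - F 0)"
      if "r \<ge> 0" "h \<ge> 0" for r h
    proof -
      have "blinfun_apply (S h) (F r) = integral {0..r} (\<lambda>s. blinfun_apply (S h) (f s))"
        unfolding F_def
        by (rule integral_linear[OF int blinfun.bounded_linear_right, unfolded o_def, symmetric]) simp
      also have "\<dots> = integral {0..r} (\<lambda>s. f (s + h))"
        using that C0_semigroup_add[OF S, of h, symmetric]
        by (intro Henstock_Kurzweil_Integration.integral_cong) (simp add: f_def add.commute)
      also have "\<dots> = integral {h..r + h} f"
        using integral_shift_real_ivl[of h h "r + h" f] by simp
      also have "\<dots> = F (r + h) - F h"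
        using Henstock_Kurzweil_Integration.integral_combine[of 0 h "r + h" f] that int
        by (simp add: F_def algebra_simps)
      finally show ?thesis by (simp add: F0)
    qed
    have FD: "F r \<in> D" if "r \<ge> 0" for r
    proof -
      have "((\<lambda>h. (F (r + h) - F r) /\<^sub>R h - (F (0 + h) - F 0) /\<^sub>R h) \<longlongrightarrow> f r - f 0) (at_right 0)"
        using that by (intro tendsto_diff quot) auto
      then have "((\<lambda>h. (blinfun_apply (S h) (F r) - F r) /\<^sub>R h) \<longlongrightarrow> f r - f 0) (at_right 0)"
        by (rule Lim_transform_eventually)
           (rule eventually_mono[OF eventually_at_right_less],
            simp only: SF[OF that less_imp_le] scaleR_diff_right)
      then show ?thesis by (rule generator_domainI[OF gen])
    qed
    have scale: "c *\<^sub>R y \<in> D" if "y \<in> D" for c y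
    proof -
      have "((\<lambda>h. c *\<^sub>R ((blinfun_apply (S h) y - y) /\<^sub>R h)) \<longlongrightarrow> c *\<^sub>R A y) (at_right 0)"
        by (rule tendsto_scaleR[OF tendsto_const generator_tendsto[OF gen that]])
      moreover have "c *\<^sub>R ((blinfun_apply (S h) y - y) /\<^sub>R h)
          = (blinfun_apply (S h) (c *\<^sub>R y) - c *\<^sub>R y) /\<^sub>R h" for h
        by (simp add: blinfun.scaleR_right scaleR_diff_right mult.commute)
      ultimately show ?thesis by (simp add: generator_domainI[OF gen])
    qed
    have "((\<lambda>h. F h /\<^sub>R h) \<longlongrightarrow> x) (at_right 0)"
      using quot[of 0] by (simp add: F0 f_def C0_semigroup_0[OF S])
    moreover have "eventually (\<lambda>h. F h /\<^sub>R h \<in> closure D) (at_right 0)"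
      by (intro eventually_mono[OF eventually_at_right_less] subsetD[OF closure_subset] scale FD)
         (rule less_imp_le)
    ultimately show ?thesis
      by (intro Lim_in_closed_set[of "closure D"]) auto
  qed
  then show ?thesis by blast
qed

lemma generator_domain_invariant:
  fixes T :: "real \<Rightarrow> 'a::banach \<Rightarrow>\<^sub>L 'a"
  assumes gen: "generates D A T" and "x \<in> D" "t \<ge> 0"
  shows "blinfun_apply (T t) x \<in> D"
proof -
  have T: "C0_semigroup T" using gen by (simp add: generates_def)
  have "((\<lambda>h. blinfun_apply (T t) ((blinfun_apply (T h) x - x) /\<^sub>R h))
      \<longlongrightarrow> blinfun_apply (T t) (A x)) (at_right 0)"
    by (rule blinfun.tendsto[OF tendsto_const generator_tendsto[OF gen \<open>x \<in> D\<close>]])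
  then have "((\<lambda>h. (blinfun_apply (T h) (blinfun_apply (T t) x) - blinfun_apply (T t) x) /\<^sub>R h)
      \<longlongrightarrow> blinfun_apply (T t) (A x)) (at_right 0)"
  proof (rule Lim_transform_eventually)
    have "blinfun_apply (T t) (blinfun_apply (T h) x) = blinfun_apply (T h) (blinfun_apply (T t) x)"
      if "h > 0" for h
      using C0_semigroup_add[OF T, of t h x] C0_semigroup_add[OF T, of h t x] that \<open>t \<ge> 0\<close>
      by (simp add: add.commute)
    then show "\<forall>\<^sub>F h in at_right 0. blinfun_apply (T t) ((blinfun_apply (T h) x - x) /\<^sub>R h)
        = (blinfun_apply (T h) (blinfun_apply (T t) x) - blinfun_apply (T t) x) /\<^sub>R h"
      by (auto simp: eventually_at_filter blinfun.scaleR_right blinfun.diff_right)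
  qed
  then show ?thesis by (rule generator_domainI[OF gen])
qed

section \<open>Bounded perturbations of the generator\<close>

text \<open>
  A mean value inequality from right derivatives alone.  The slope is relaxed from \<open>K\<close> to
  \<open>K + e\<close>, which leaves room to continue past the infimum \<open>c\<close> of the times at which
  the relaxed bound fails; up to and including \<open>c\<close> it holds by continuity.
\<close>

lemma right_quotient_bound_imp_increment_bound:
  fixes f :: "real \<Rightarrow> 'a::real_normed_vector"
  assumes "a \<le> b" and cont: "continuous_on {a..b} f"
    and deriv: "\<And>t. a \<le> t \<Longrightarrow> t < b \<Longrightarrow>
      \<exists>d. ((\<lambda>h. (f (t + h) - f t) /\<^sub>R h) \<longlongrightarrow> d) (at_right 0) \<and> norm d \<le> K"
  shows "norm (f b - f a) \<le> K * (b - a)"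
proof (rule field_le_epsilon)
  fix e' :: real assume "e' > 0"
  \<comment> \<open>The summand \<open>1\<close> covers \<open>a = b\<close>.\<close>
  define e where "e = e' / (b - a + 1)"
  have e: "e > 0" "e * (b - a) \<le> e'"
    using \<open>e' > 0\<close> \<open>a \<le> b\<close> by (simp_all add: e_def divide_simps)
  define ok where "ok t \<longleftrightarrow> norm (f t - f a) \<le> (K + e) * (t - a)" for t
  have "ok b"
  proof (rule ccontr)
    assume "\<not> ok b"
    define B where "B = {t \<in> {a..b}. \<not> ok t}"
    define c where "c = Inf B"
    have B: "b \<in> B" "bdd_below B" using \<open>\<not> ok b\<close> \<open>a \<le> b\<close> by (auto simp: B_def)
    have "a \<le> c"
      unfolding c_def by (rule cInf_greatest) (use B(1) in \<open>auto simp: B_def\<close>)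
    moreover have "c \<le> b"
      unfolding c_def by (rule cInf_lower[OF B])
    ultimately have c: "a \<le> c" "c \<le> b" .
    have before: "ok t" if "a \<le> t" "t < c" for t
    proof (rule ccontr)
      assume "\<not> ok t"
      then have "t \<in> B" using that c by (simp add: B_def)
      then have "c \<le> t" unfolding c_def by (rule cInf_lower[OF _ B(2)])
      then show False using that by simp
    qed
    have "ok c"
    proof (cases "a = c")
      case False
      with c have "a < c" by simp
      have "continuous_on {a..c} f"
        using c by (intro continuous_on_subset[OF cont]) simp
      then have "(f \<longlongrightarrow> f c) (at_left c)"
        by (rule continuous_on_Icc_at_leftD) (rule \<open>a < c\<close>)
      then have "((\<lambda>t. norm (f t - f a)) \<longlongrightarrow> norm (f c - f a)) (at_left c)"
        by (intro tendsto_norm tendsto_diff tendsto_const)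
      moreover have "((\<lambda>t. (K + e) * (t - a)) \<longlongrightarrow> (K + e) * (c - a)) (at_left c)"
        by (intro tendsto_intros)
      moreover have "eventually (\<lambda>t. norm (f t - f a) \<le> (K + e) * (t - a)) (at_left c)"
        unfolding eventually_at_left[OF \<open>a < c\<close>] using before \<open>a < c\<close>
        by (intro exI[of _ a]) (auto simp: ok_def)
      ultimately show ?thesis
        unfolding ok_def by (intro tendsto_le[OF trivial_limit_at_left_real])
    qed (simp add: ok_def)
    then have "c < b" using c \<open>\<not> ok b\<close> by (cases "c = b") auto
    with deriv c obtain d where
      d: "((\<lambda>h. (f (c + h) - f c) /\<^sub>R h) \<longlongrightarrow> d) (at_right 0)" "norm d \<le> K" by blast
    have "eventually (\<lambda>h. norm ((f (c + h) - f c) /\<^sub>R h) < K + e) (at_right 0)"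
      using d e by (intro order_tendstoD(2)[OF tendsto_norm[OF d(1)]]) auto
    then obtain r where r: "r > 0"
      "\<And>h. 0 < h \<Longrightarrow> h < r \<Longrightarrow> norm ((f (c + h) - f c) /\<^sub>R h) < K + e"
      unfolding eventually_at_right_field by auto
    have after: "ok t" if "c \<le> t" "t < c + r" for t
    proof (cases "t = c")
      case False
      then have "norm ((f t - f c) /\<^sub>R (t - c)) < K + e" using r(2)[of "t - c"] that by simp
      moreover have "norm ((f t - f c) /\<^sub>R (t - c)) = norm (f t - f c) / (t - c)"
        using that by (simp add: divide_inverse_commute)
      ultimately have "norm (f t - f c) < (K + e) * (t - c)"
        using that False by (simp add: pos_divide_less_eq)
      moreover have "norm (f t - f a) \<le> norm (f t - f c) + norm (f c - f a)"
        using norm_triangle_ineq[of "f t - f c" "f c - f a"] by simp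
      ultimately show ?thesis using \<open>ok c\<close> by (simp add: ok_def algebra_simps)
    qed (simp add: \<open>ok c\<close>)
    have "c + r \<le> t" if "t \<in> B" for t
    proof (rule ccontr)
      assume "\<not> c + r \<le> t"
      then have "ok t" using before[of t] after[of t] that by (cases "t < c") (auto simp: B_def)
      then show False using that by (simp add: B_def)
    qed
    then have "c + r \<le> Inf B"
      using B(1) by (intro cInf_greatest) auto
    then show False using r by (simp add: c_def)
  qed
  then show "norm (f b - f a) \<le> K * (b - a) + e'"
    using e by (simp add: ok_def algebra_simps)
qed

text \<open>
  The function \<open>f s = S(h - s) T(s) x + s B x\<close> interpolates between \<open>S(h) x\<close> and
  \<open>T(h) x + h B x\<close>.  With \<open>y = T(t) x\<close> its increment at \<open>t\<close> is
  \<open>S(h - t - \<tau>) (T(\<tau>) y - S(\<tau>) y) + \<tau> B x\<close>, and the two generators differ by \<open>B\<close> at \<open>y\<close>,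
  so the right derivative is \<open>B x - S(h - t) B T(t) x\<close>.  A left increment would
  involve \<open>S(\<tau>) - T(\<tau>)\<close> at a point that moves with \<open>\<tau>\<close>; this is why right derivatives are used.
\<close>

lemma perturbed_semigroup_expansion_on_domain:
  fixes T S :: "real \<Rightarrow> 'a::banach \<Rightarrow>\<^sub>L 'a"
  assumes genT: "generates D A T"
    and genS: "generates D (\<lambda>x. A x + blinfun_apply B x) S"
    and x: "x \<in> D" and h: "h \<ge> 0"
    and e: "\<And>s. 0 \<le> s \<Longrightarrow> s \<le> h \<Longrightarrow>
      norm (blinfun_apply (S (h - s)) (blinfun_apply B (blinfun_apply (T s) x)) - blinfun_apply B x) \<le> e"
  shows "norm (blinfun_apply (S h) x - blinfun_apply (T h) x - h *\<^sub>R blinfun_apply B x) \<le> e * h"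
proof -
  have T: "C0_semigroup T" and S: "C0_semigroup S"
    using genT genS by (simp_all add: generates_def)
  define f where "f s = blinfun_apply (S (h - s)) (blinfun_apply (T s) x) + s *\<^sub>R blinfun_apply B x" for s
  have "norm (f h - f 0) \<le> e * (h - 0)"
  proof (rule right_quotient_bound_imp_increment_bound[OF h])
    have "((\<lambda>s. blinfun_apply (S (h - s)) (blinfun_apply (T s) x))
        \<longlongrightarrow> blinfun_apply (S (h - t)) (blinfun_apply (T t) x)) (at t within {0..h})"
      if t: "t \<in> {0..h}" for t
      using t by (intro C0_semigroup_tendsto[OF S] C0_semigroup_tendsto[OF T] tendsto_intros)
        (auto simp: eventually_at_filter)
    then show "continuous_on {0..h} f"
      unfolding f_def continuous_on_def
      by (intro ballI tendsto_add tendsto_scaleR tendsto_const tendsto_ident_at)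
  next
    fix t assume t: "0 \<le> t" "t < h"
    define y where "y = blinfun_apply (T t) x"
    have y: "y \<in> D" unfolding y_def using generator_domain_invariant[OF genT x t(1)] .
    have "((\<lambda>\<tau>. (blinfun_apply (T \<tau>) y - y) /\<^sub>R \<tau> - (blinfun_apply (S \<tau>) y - y) /\<^sub>R \<tau>)
        \<longlongrightarrow> A y - (A y + blinfun_apply B y)) (at_right 0)"
      by (intro tendsto_diff generator_tendsto[OF genT y] generator_tendsto[OF genS y])
    then have quot: "((\<lambda>\<tau>. (blinfun_apply (T \<tau>) y - blinfun_apply (S \<tau>) y) /\<^sub>R \<tau>)
        \<longlongrightarrow> - blinfun_apply B y) (at_right 0)"
      by (simp add: scaleR_diff_right)
    have small: "eventually (\<lambda>\<tau>. 0 < \<tau> \<and> \<tau> < h - t) (at_right 0)"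
      unfolding eventually_at_right_field using t by (intro exI[of _ "h - t"]) auto
    have "((\<lambda>\<tau>. h - t - \<tau>) \<longlongrightarrow> h - t - 0) (at_right 0)"
      by (intro tendsto_intros)
    moreover have "eventually (\<lambda>\<tau>. h - t - \<tau> \<ge> 0) (at_right 0)"
      by (rule eventually_mono[OF small]) simp
    ultimately have "((\<lambda>\<tau>. blinfun_apply (S (h - t - \<tau>))
          ((blinfun_apply (T \<tau>) y - blinfun_apply (S \<tau>) y) /\<^sub>R \<tau>) + blinfun_apply B x)
        \<longlongrightarrow> blinfun_apply (S (h - t - 0)) (- blinfun_apply B y) + blinfun_apply B x) (at_right 0)"
      using t by (intro tendsto_add tendsto_const C0_semigroup_tendsto[OF S] quot) auto
    then have "((\<lambda>\<tau>. (f (t + \<tau>) - f t) /\<^sub>R \<tau>)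
        \<longlongrightarrow> blinfun_apply (S (h - t - 0)) (- blinfun_apply B y) + blinfun_apply B x) (at_right 0)"
    proof (rule Lim_transform_eventually)
      have "blinfun_apply (S (h - t - \<tau>))
          ((blinfun_apply (T \<tau>) y - blinfun_apply (S \<tau>) y) /\<^sub>R \<tau>) + blinfun_apply B x
        = (f (t + \<tau>) - f t) /\<^sub>R \<tau>" if \<tau>: "0 < \<tau>" "\<tau> < h - t" for \<tau>
      proof -
        have "blinfun_apply (S (h - t)) y = blinfun_apply (S (h - t - \<tau>)) (blinfun_apply (S \<tau>) y)"
          using C0_semigroup_add[OF S, of "h - t - \<tau>" \<tau> y] \<tau> by simp
        moreover have "blinfun_apply (T (t + \<tau>)) x = blinfun_apply (T \<tau>) y"
          using C0_semigroup_add[OF T, of \<tau> t x] \<tau> t by (simp add: y_def add.commute)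
        ultimately have "f (t + \<tau>) - f t = blinfun_apply (S (h - t - \<tau>))
            (blinfun_apply (T \<tau>) y - blinfun_apply (S \<tau>) y) + \<tau> *\<^sub>R blinfun_apply B x"
          unfolding f_def y_def[symmetric]
          by (simp add: blinfun.diff_right scaleR_add_left diff_diff_eq)
        then show ?thesis
          using \<tau> by (simp add: blinfun.scaleR_right scaleR_add_right)
      qed
      then show "\<forall>\<^sub>F \<tau> in at_right 0. blinfun_apply (S (h - t - \<tau>))
          ((blinfun_apply (T \<tau>) y - blinfun_apply (S \<tau>) y) /\<^sub>R \<tau>) + blinfun_apply B x
        = (f (t + \<tau>) - f t) /\<^sub>R \<tau>"
        by (intro eventually_mono[OF small]) (elim conjE)
    qed
    moreover have "norm (blinfun_apply (S (h - t - 0)) (- blinfun_apply B y) + blinfun_apply B x) \<le> e"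
      using e[of t] t by (simp add: y_def blinfun.minus_right norm_minus_commute)
    ultimately show "\<exists>d. ((\<lambda>\<tau>. (f (t + \<tau>) - f t) /\<^sub>R \<tau>) \<longlongrightarrow> d) (at_right 0) \<and> norm d \<le> e"
      by blast
  qed
  moreover have "f h - f 0 = - (blinfun_apply (S h) x - blinfun_apply (T h) x - h *\<^sub>R blinfun_apply B x)"
    by (simp add: f_def C0_semigroup_0[OF T] C0_semigroup_0[OF S])
  ultimately show ?thesis by (simp only: norm_minus_cancel diff_zero)
qed

text \<open>
  The bound of the previous lemma is applied to points \<open>u n\<close> of the domain that converge to \<open>x\<close>.
  The deviation \<open>g z r s\<close> that enters it is small at \<open>z = x\<close> for short times, and Lipschitz in \<open>z\<close>
  uniformly in those times, so for a fixed step \<open>h\<close> letting \<open>n \<longlonglongrightarrow> \<infinity>\<close> leaves only its size at \<open>x\<close>.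
\<close>

lemma perturbed_semigroup_difference_quotient:
  fixes T S :: "real \<Rightarrow> 'a::banach \<Rightarrow>\<^sub>L 'a"
  assumes genT: "generates D A T"
    and genS: "generates D (\<lambda>x. A x + blinfun_apply B x) S"
  shows "((\<lambda>h. (blinfun_apply (S h) x - blinfun_apply (T h) x) /\<^sub>R h) \<longlongrightarrow> blinfun_apply B x) (at_right 0)"
proof (rule tendstoI)
  fix e' :: real assume "e' > 0"
  define e where "e = e' / 2"
  have "e > 0" using \<open>e' > 0\<close> by (simp add: e_def)
  have T: "C0_semigroup T" and S: "C0_semigroup S"
    using genT genS by (simp_all add: generates_def)
  obtain KT where KT: "KT \<ge> 0" "\<And>s. s \<in> {0..1} \<Longrightarrow> norm (T s) \<le> KT"
    using C0_semigroup_bounded_on_compact[OF T] by blast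
  obtain KS where KS: "KS \<ge> 0" "\<And>s. s \<in> {0..1} \<Longrightarrow> norm (S s) \<le> KS"
    using C0_semigroup_bounded_on_compact[OF S] by blast
  define N where "N = KS * (norm B * KT) + norm B"
  define g where "g z r s = blinfun_apply (S r) (blinfun_apply B (blinfun_apply (T s) z)) - blinfun_apply B z"
    for z r s
  let ?F = "at (0, 0) within {0..} \<times> {0..} :: (real \<times> real) filter"
  have nonneg: "eventually (\<lambda>p. 0 \<le> fst p) ?F" "eventually (\<lambda>p. 0 \<le> snd p) ?F"
    unfolding eventually_at by (auto intro!: exI[of _ 1])
  have "(fst \<longlongrightarrow> fst (0, 0 :: real)) ?F" "(snd \<longlongrightarrow> snd (0 :: real, 0)) ?F"
    by (intro tendsto_intros)+
  then have "((\<lambda>p. g x (fst p) (snd p)) \<longlongrightarrow>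
      blinfun_apply (S 0) (blinfun_apply B (blinfun_apply (T 0) x)) - blinfun_apply B x) ?F"
    unfolding g_def using nonneg
    by (intro tendsto_diff tendsto_const C0_semigroup_tendsto[OF S] C0_semigroup_tendsto[OF T]
        blinfun.tendsto) auto
  then have "((\<lambda>p. g x (fst p) (snd p)) \<longlongrightarrow> 0) ?F"
    by (simp add: C0_semigroup_0[OF T] C0_semigroup_0[OF S])
  then have "eventually (\<lambda>p. norm (g x (fst p) (snd p)) < e) ?F"
    using \<open>e > 0\<close> by (auto simp: tendsto_iff)
  then obtain d where d: "d > 0"
    "\<And>p. p \<in> {0..} \<times> {0..} \<Longrightarrow> p \<noteq> (0, 0) \<Longrightarrow> dist p (0, 0) < d \<Longrightarrow> norm (g x (fst p) (snd p)) < e"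
    unfolding eventually_at by auto
  have small: "norm (g x r s) \<le> e" if "0 \<le> r" "0 \<le> s" "r + s < d" for r s
  proof (cases "r = 0 \<and> s = 0")
    case True
    then show ?thesis using \<open>e > 0\<close> by (simp add: g_def C0_semigroup_0[OF T] C0_semigroup_0[OF S])
  next
    case False
    have "dist (r, s) (0, 0) \<le> r + s"
      using that sqrt_sum_squares_le_sum[of r s] by (simp add: dist_Pair_Pair)
    then show ?thesis using d(2)[of "(r, s)"] that False by auto
  qed
  have lipschitz: "norm (g z r s) \<le> norm (g x r s) + N * norm (z - x)"
    if "r \<in> {0..1}" "s \<in> {0..1}" for z r s
  proof -
    have "norm (blinfun_apply (S r) (blinfun_apply B (blinfun_apply (T s) (z - x))))
        \<le> KS * (norm B * (KT * norm (z - x)))"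
      using that KT KS
      by (intro order_trans[OF norm_blinfun mult_mono]) auto
    moreover have "norm (blinfun_apply B (z - x)) \<le> norm B * norm (z - x)"
      by (rule norm_blinfun)
    moreover have "g z r s = g x r s
        + (blinfun_apply (S r) (blinfun_apply B (blinfun_apply (T s) (z - x))) - blinfun_apply B (z - x))"
      by (simp add: g_def blinfun.diff_right)
    then have "norm (g z r s) \<le> norm (g x r s)
        + (norm (blinfun_apply (S r) (blinfun_apply B (blinfun_apply (T s) (z - x)))) + norm (blinfun_apply B (z - x)))"
      by (simp only:) (intro norm_triangle_mono order_refl norm_triangle_ineq4)
    ultimately show ?thesis by (simp add: N_def algebra_simps)
  qed
  have "x \<in> closure D" using generator_domain_dense[OF genT] by simp
  then obtain u where u: "\<And>n. u n \<in> D" "u \<longlonglongrightarrow> x"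
    unfolding closure_sequential by blast
  have bound: "norm (blinfun_apply (S h) x - blinfun_apply (T h) x - h *\<^sub>R blinfun_apply B x) \<le> e * h"
    if h: "0 < h" "h < d" "h \<le> 1" for h
  proof (rule LIMSEQ_le)
    have "(\<lambda>n. norm (blinfun_apply (S h) (u n) - blinfun_apply (T h) (u n) - h *\<^sub>R blinfun_apply B (u n)))
        \<longlonglongrightarrow> norm (blinfun_apply (S h) x - blinfun_apply (T h) x - h *\<^sub>R blinfun_apply B x)"
      by (intro tendsto_intros blinfun.tendsto u)
    then show "(\<lambda>n. norm (blinfun_apply (S h) (u n) - blinfun_apply (T h) (u n) - h *\<^sub>R blinfun_apply B (u n)))
        \<longlonglongrightarrow> norm (blinfun_apply (S h) x - blinfun_apply (T h) x - h *\<^sub>R blinfun_apply B x)" .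
    have "(\<lambda>n. (e + N * norm (u n - x)) * h) \<longlonglongrightarrow> (e + N * norm (x - x)) * h"
      by (intro tendsto_intros u)
    then show "(\<lambda>n. (e + N * norm (u n - x)) * h) \<longlonglongrightarrow> e * h" by simp
    have "norm (blinfun_apply (S h) (u n) - blinfun_apply (T h) (u n) - h *\<^sub>R blinfun_apply B (u n))
        \<le> (e + N * norm (u n - x)) * h" for n
    proof (rule perturbed_semigroup_expansion_on_domain[OF genT genS u(1)])
      fix s assume "0 \<le> s" "s \<le> h"
      then show "norm (blinfun_apply (S (h - s)) (blinfun_apply B (blinfun_apply (T s) (u n)))
          - blinfun_apply B (u n)) \<le> e + N * norm (u n - x)"
        using lipschitz[of "h - s" s "u n"] small[of "h - s" s] h by (simp add: g_def)
    qed (use h in simp)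
    then show "\<exists>m. \<forall>n\<ge>m. norm (blinfun_apply (S h) (u n) - blinfun_apply (T h) (u n) - h *\<^sub>R blinfun_apply B (u n))
        \<le> (e + N * norm (u n - x)) * h" by blast
  qed
  have "dist ((blinfun_apply (S h) x - blinfun_apply (T h) x) /\<^sub>R h) (blinfun_apply B x) < e'"
    if h: "0 < h" "h < min d 1" for h
  proof -
    have "(blinfun_apply (S h) x - blinfun_apply (T h) x) /\<^sub>R h - blinfun_apply B x
        = (blinfun_apply (S h) x - blinfun_apply (T h) x - h *\<^sub>R blinfun_apply B x) /\<^sub>R h"
      using h by (simp add: scaleR_diff_right)
    then have "dist ((blinfun_apply (S h) x - blinfun_apply (T h) x) /\<^sub>R h) (blinfun_apply B x)
        = norm (blinfun_apply (S h) x - blinfun_apply (T h) x - h *\<^sub>R blinfun_apply B x) / h"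
      using h by (simp add: dist_norm divide_inverse_commute)
    also have "\<dots> \<le> e" using bound[of h] h by (simp add: pos_divide_le_eq)
    also have "\<dots> < e'" using \<open>e' > 0\<close> by (simp add: e_def)
    finally show ?thesis .
  qed
  moreover have "min d 1 > 0" using d(1) by simp
  ultimately show "eventually (\<lambda>h. dist ((blinfun_apply (S h) x - blinfun_apply (T h) x) /\<^sub>R h)
      (blinfun_apply B x) < e') (at_right 0)"
    unfolding eventually_at_right_field by blast
qed

section \<open>The weighted maximum along a stable semigroup\<close>

locale exponentially_stable_semigroup =
  fixes S :: "real \<Rightarrow> 'a::banach \<Rightarrow>\<^sub>L 'a" and M \<mu> \<eta> :: real
  assumes semigroup: "C0_semigroup S"
    and M_pos: "M > 0"
    and decay: "\<And>x t. t \<ge> 0 \<Longrightarrow> norm (blinfun_apply (S t) x) \<le> M * exp (- \<mu> * t) * norm x"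
    and rate: "\<eta> < \<mu>"
begin

abbreviation V :: "'a \<Rightarrow> real" where "V \<equiv> V_max S \<eta>"

definition weighted :: "'a \<Rightarrow> real \<Rightarrow> real" where
  "weighted x s = norm (exp (\<eta> * s) *\<^sub>R blinfun_apply (S s) x)"

lemma weighted_le: "s \<ge> 0 \<Longrightarrow> weighted x s \<le> M * exp (- (\<mu> - \<eta>) * s) * norm x"
proof -
  assume "s \<ge> 0"
  then have "weighted x s \<le> exp (\<eta> * s) * (M * exp (- \<mu> * s) * norm x)"
    using decay[of s x] by (simp add: weighted_def)
  also have "\<dots> = M * (exp (\<eta> * s) * exp (- \<mu> * s)) * norm x" by simp
  also have "exp (\<eta> * s) * exp (- \<mu> * s) = exp (- (\<mu> - \<eta>) * s)"
    by (simp add: exp_add[symmetric] algebra_simps)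
  finally show ?thesis .
qed

text \<open>
  If the weighted orbit is positive somewhere, it lies below that value outside a compact
  interval, so a maximum over this interval is global.
\<close>

lemma weighted_attains_max: "\<exists>s\<ge>0. \<forall>r\<ge>0. weighted x r \<le> weighted x s"
proof (cases "\<exists>r\<ge>0. weighted x r > 0")
  case False
  then show ?thesis by (metis norm_ge_zero not_le order_refl order_trans weighted_def)
next
  case True
  then obtain r0 where r0: "r0 \<ge> 0" "weighted x r0 > 0" by blast
  have "((\<lambda>s. M * exp (- (\<mu> - \<eta>) * s) * norm x) \<longlongrightarrow> 0) at_top"
    using rate by real_asymp
  then have "eventually (\<lambda>s. M * exp (- (\<mu> - \<eta>) * s) * norm x < weighted x r0) at_top"
    using r0 by (intro order_tendstoD(2))
  then obtain b where b: "\<And>s. s \<ge> b \<Longrightarrow> M * exp (- (\<mu> - \<eta>) * s) * norm x < weighted x r0"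
    unfolding eventually_at_top_linorder by blast
  define c where "c = max b r0"
  have "continuous_on {0..c} (weighted x)"
    unfolding weighted_def
    by (intro continuous_intros continuous_on_subset[OF C0_semigroup_continuous_orbit[OF semigroup]]) auto
  moreover have "{0..c} \<noteq> {}" using r0 by (simp add: c_def)
  ultimately obtain s where s: "s \<in> {0..c}" "\<And>r. r \<in> {0..c} \<Longrightarrow> weighted x r \<le> weighted x s"
    using continuous_attains_sup[OF compact_Icc, of 0 c "weighted x"] by blast
  have "weighted x r \<le> weighted x s" if "r \<ge> 0" for r
  proof (cases "r \<le> c")
    case True
    then show ?thesis using s(2) that by simp
  next
    case False
    then have "b \<le> r" by (simp add: c_def)
    then have "weighted x r \<le> weighted x r0"
      using weighted_le[OF that, of x] b[of r] by linarith
    also have "\<dots> \<le> weighted x s" using r0 by (intro s(2)) (simp add: c_def)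
    finally show ?thesis .
  qed
  with s(1) show ?thesis by auto
qed

lemma V_attained: "\<exists>s\<ge>0. V x = weighted x s \<and> (\<forall>r\<ge>0. weighted x r \<le> V x)"
proof -
  obtain s where s: "s \<ge> 0" "\<And>r. r \<ge> 0 \<Longrightarrow> weighted x r \<le> weighted x s"
    using weighted_attains_max by blast
  have "V x = weighted x s"
    unfolding V_max_def weighted_def[symmetric]
    by (rule Greatest_equality) (use s in auto)
  with s show ?thesis by auto
qed

lemma weighted_le_V: "r \<ge> 0 \<Longrightarrow> weighted x r \<le> V x"
  using V_attained by blast

lemma V_le: "(\<And>r. r \<ge> 0 \<Longrightarrow> weighted x r \<le> c) \<Longrightarrow> V x \<le> c"
  using V_attained by metis

lemma norm_le_V: "norm x \<le> V x"
  using weighted_le_V[of 0 x] by (simp add: weighted_def C0_semigroup_0[OF semigroup])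

lemma V_le_norm: "V x \<le> M * norm x"
proof (rule V_le)
  fix r :: real assume r: "r \<ge> 0"
  have "M * exp (- (\<mu> - \<eta>) * r) \<le> M * 1"
    using M_pos rate r by (intro mult_left_mono) (simp_all add: mult_nonpos_nonneg)
  then have "M * exp (- (\<mu> - \<eta>) * r) * norm x \<le> M * norm x"
    by (intro mult_right_mono) auto
  with weighted_le[OF r, of x] show "weighted x r \<le> M * norm x" by linarith
qed

lemma V_triangle: "V (x + y) \<le> V x + V y"
proof (rule V_le)
  fix r :: real assume r: "r \<ge> 0"
  have "weighted (x + y) r \<le> weighted x r + weighted y r"
    unfolding weighted_def by (metis blinfun.add_right norm_triangle_ineq scaleR_add_right)
  with weighted_le_V[OF r, of x] weighted_le_V[OF r, of y]
  show "weighted (x + y) r \<le> V x + V y" by linarith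
qed

lemma V_le_add: "V y \<le> V x + M * norm (y - x)"
  using V_triangle[of x "y - x"] V_le_norm[of "y - x"] by simp

lemma V_continuous: "continuous_on A V"
proof -
  have "\<bar>V y - V x\<bar> \<le> M * norm (y - x)" for x y
    using V_le_add[of y x] V_le_add[of x y] by (simp add: norm_minus_commute)
  then have "M-lipschitz_on A V"
    using M_pos by (intro lipschitz_onI) (auto simp: dist_norm)
  then show ?thesis by (rule lipschitz_on_continuous_on)
qed

text \<open>
  Advancing the state by \<open>t\<close> shifts the weighted orbit to the left by \<open>t\<close> and rescales it by
  \<open>exp (- \<eta> t)\<close>; the maximum is then over fewer times.
\<close>

lemma V_decay: "t \<ge> 0 \<Longrightarrow> V (blinfun_apply (S t) x) \<le> exp (- \<eta> * t) * V x"
proof (rule V_le)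
  fix r :: real assume t: "t \<ge> 0" and r: "r \<ge> 0"
  have "exp (\<eta> * r) = exp (- \<eta> * t) * exp (\<eta> * (r + t))"
    by (simp add: exp_add[symmetric] algebra_simps)
  then have "weighted (blinfun_apply (S t) x) r = exp (- \<eta> * t) * weighted x (r + t)"
    using C0_semigroup_add[OF semigroup r t] by (simp add: weighted_def)
  also have "\<dots> \<le> exp (- \<eta> * t) * V x"
    using r t by (intro mult_left_mono weighted_le_V) auto
  finally show "weighted (blinfun_apply (S t) x) r \<le> exp (- \<eta> * t) * V x" .
qed

text \<open>
  Along \<open>S\<close> the function decays with rate \<open>\<eta>\<close>, and replacing \<open>S(h) x\<close> by \<open>T(h) x\<close>
  costs at most \<open>M\<close> times their distance, which is \<open>h \<parallel>b\<parallel>\<close> to first order.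
\<close>

lemma lie_derivative_V_le:
  assumes quot: "((\<lambda>h. (blinfun_apply (S h) x - blinfun_apply (T h) x) /\<^sub>R h) \<longlongrightarrow> b) (at_right 0)"
  shows "lie_derivative (mild_solution T) V x \<le> ereal (- \<eta> * V x + M * norm b)"
proof -
  define q where "q h = (blinfun_apply (S h) x - blinfun_apply (T h) x) /\<^sub>R h" for h
  define u where "u h = (exp (- \<eta> * h) - 1) / h * V x + M * norm (q h)" for h
  have "((\<lambda>h. (exp (- \<eta> * h) - 1) / h) \<longlongrightarrow> - \<eta>) (at_right 0)"
    by real_asymp
  then have "(u \<longlongrightarrow> - \<eta> * V x + M * norm b) (at_right 0)"
    unfolding u_def using quot[folded q_def] by (intro tendsto_intros)
  then have "Limsup (at_right 0) (\<lambda>h. ereal (u h)) = ereal (- \<eta> * V x + M * norm b)"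
    by (intro lim_imp_Limsup) auto
  moreover have "(V (mild_solution T h x) - V x) / h \<le> u h" if h: "h > 0" for h
  proof -
    have "norm (blinfun_apply (T h) x - blinfun_apply (S h) x) = h * norm (q h)"
      using h by (simp add: q_def norm_minus_commute)
    then have "V (blinfun_apply (T h) x) \<le> exp (- \<eta> * h) * V x + M * (h * norm (q h))"
      using V_le_add[of "blinfun_apply (T h) x" "blinfun_apply (S h) x"] V_decay[of h x] h by simp
    moreover have "u h * h = (exp (- \<eta> * h) - 1) * V x + M * (h * norm (q h))"
      using h by (simp add: u_def distrib_right)
    ultimately have "V (mild_solution T h x) - V x \<le> u h * h"
      by (simp add: mild_solution_def algebra_simps)
    then show ?thesis using h by (simp add: pos_divide_le_eq)
  qed
  then have "eventually (\<lambda>h. ereal ((V (mild_solution T h x) - V x) / h) \<le> ereal (u h)) (at_right 0)"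
    by (intro eventually_mono[OF eventually_at_right_less]) simp
  then have "lie_derivative (mild_solution T) V x \<le> Limsup (at_right 0) (\<lambda>h. ereal (u h))"
    unfolding lie_derivative_def by (rule Limsup_mono)
  ultimately show ?thesis by simp
qed

end

section \<open>The Lyapunov function\<close>

lemma linear_in_class_K_infinity:
  assumes "c > 0"
  shows "(\<lambda>r. c * r) \<in> class_K_infinity"
proof -
  have "\<not> bdd_above ((\<lambda>r. c * r) ` {0..})"
  proof
    assume "bdd_above ((\<lambda>r. c * r) ` {0..})"
    then obtain B where B: "\<And>r. r \<ge> 0 \<Longrightarrow> c * r \<le> B" by (auto simp: bdd_above_def)
    have "c * ((\<bar>B\<bar> + 1) / c) \<le> B" using assms by (intro B) simp
    then show False using assms by simp
  qed
  then show ?thesis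
    using assms by (auto simp: class_K_infinity_def strict_mono_on_def intro!: continuous_intros)
qed

theorem proposition4p2:
  fixes T T_LC :: "real \<Rightarrow> 'a::banach \<Rightarrow>\<^sub>L 'a"
    and D :: "'a set" and A :: "'a \<Rightarrow> 'a"
    and C :: "'a \<Rightarrow>\<^sub>L 'b::banach" and L :: "'b \<Rightarrow>\<^sub>L 'a"
    and M \<mu> \<eta> :: real
  assumes "generates D A T"
    and "generates D (\<lambda>x. A x + blinfun_apply L (blinfun_apply C x)) T_LC"
    and "M > 0" and "\<mu> > 0"
    and "\<And>x t. t \<ge> 0 \<Longrightarrow> norm (blinfun_apply (T_LC t) x) \<le> M * exp (- \<mu> * t) * norm x"
    and "0 < \<eta>" and "\<eta> < \<mu>"
  shows "(\<forall>x. \<exists>s\<ge>0. V_max T_LC \<eta> x = norm (exp (\<eta> * s) *\<^sub>R blinfun_apply (T_LC s) x) \<and>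
            (\<forall>r\<ge>0. norm (exp (\<eta> * r) *\<^sub>R blinfun_apply (T_LC r) x) \<le> V_max T_LC \<eta> x)) \<and>
         (\<exists>c. coercive_eOSS_Lyapunov_with 1 (\<lambda>r. c * r) T C (V_max T_LC \<eta>))"
proof -
  have T: "C0_semigroup T" and T_LC: "C0_semigroup T_LC"
    using assms(1,2) by (simp_all add: generates_def)
  interpret exponentially_stable_semigroup T_LC M \<mu> \<eta>
    using T_LC assms by unfold_locales
  \<comment> \<open>Adding \<open>1\<close> keeps the gain strictly increasing when \<open>L = 0\<close>.\<close>
  define c where "c = M * norm L + 1"
  have "c > 0" using assms(3) by (simp add: c_def add_nonneg_pos)
  have lie: "lie_derivative (mild_solution T) V x
      \<le> ereal (- \<eta> * norm x powr 1 + c * norm (blinfun_apply C x))" for x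
  proof -
    have "generates D (\<lambda>x. A x + blinfun_apply (L o\<^sub>L C) x) T_LC"
      using assms(2) by simp
    then have "lie_derivative (mild_solution T) V x
        \<le> ereal (- \<eta> * V x + M * norm (blinfun_apply (L o\<^sub>L C) x))"
      by (intro lie_derivative_V_le perturbed_semigroup_difference_quotient[OF assms(1)])
    also have "- \<eta> * V x + M * norm (blinfun_apply (L o\<^sub>L C) x)
        \<le> - \<eta> * norm x powr 1 + c * norm (blinfun_apply C x)"
    proof (rule add_mono)
      show "- \<eta> * V x \<le> - \<eta> * norm x powr 1"
        using norm_le_V[of x] assms(6) by simp
      have "M * norm (blinfun_apply (L o\<^sub>L C) x) \<le> M * (norm L * norm (blinfun_apply C x))"
        using assms(3) by (simp add: norm_blinfun)
      also have "\<dots> \<le> c * norm (blinfun_apply C x)" by (simp add: c_def algebra_simps)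
      finally show "M * norm (blinfun_apply (L o\<^sub>L C) x) \<le> c * norm (blinfun_apply C x)" .
    qed
    finally show ?thesis by simp
  qed
  have orbit: "continuous_on {0..} (\<lambda>t. V (mild_solution T t x))" for x
    unfolding mild_solution_def
    by (rule continuous_on_compose2[OF V_continuous C0_semigroup_continuous_orbit[OF T]]) auto
  have "coercive_eOSS_Lyapunov_with 1 (\<lambda>r. c * r) T C V"
    unfolding coercive_eOSS_Lyapunov_with_def
  proof (intro conjI allI)
    show "(\<lambda>r. c * r) \<in> class_K_infinity"
      using \<open>c > 0\<close> by (rule linear_in_class_K_infinity)
    show "0 \<le> V x" for x
      using norm_le_V[of x] norm_ge_zero[of x] by linarith
    show "\<exists>k1>0. \<exists>k2>0. \<forall>x. k1 * norm x powr 1 \<le> V x \<and> V x \<le> k2 * norm x powr 1"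
      using norm_le_V V_le_norm assms(3) by (intro exI[of _ 1] exI[of _ M] conjI allI) auto
    show "\<exists>\<alpha>>0. \<forall>x. lie_derivative (mild_solution T) V x
        \<le> ereal (- \<alpha> * norm x powr 1 + c * norm (blinfun_apply C x))"
      using lie assms(6) by blast
  qed (use orbit in auto)
  then show ?thesis using V_attained unfolding weighted_def by blast
qed

end
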